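(* Let $A,B,C$ be a Leonard triple on $V$ that has $q$-Racah type with Huang data $(a,b,c,d)$, and let $W,W',W''\in\mathrm{End}(V)$ be as defined in the context. Let $\langle A+B+C\rangle$ denote the $\mathbb F$-subalgebra of $\mathrm{End}(V)$ generated by $A+B+C$. Then $\langle A+B+C\rangle$ contains every element of $\mathrm{End}(V)$ that commutes with $A+B+C$. In particular $\langle A+B+C\rangle$ contains each of the elements $W'W$, $W''W'$, $WW''$.
   Context: Let $\mathbb F$ be a field, $d\ge 0$ an integer, $V$ a vector space over $\mathbb F$ of dimension $d+1$, $\mathrm{End}(V)$ the $\mathbb F$-algebra of $\mathbb F$-linear maps $V\to V$, and $I$ its identity. Subalgebras contain $I$. A square matrix is tridiagonal if each nonzero entry lies on the diagonal, subdiagonal or superdiagonal; a tridiagonal matrix is irreducible if every subdiagonal entry and every superdiagonal entry is nonzero. Leonard triple on $V$: a 3-tuple $A,B,C$ of elements of $\mathrm{End}(V)$ such that (i) there is a basis of $V$ with respect to which $A$ is represented by a diagonal matrix and $B,C$ by irreducible tridiagonal matrices; (ii) there is a basis with respect to which $B$ is diagonal and $C,A$ are irreducible tridiagonal; (iii) there is a basis with respect to which $C$ is diagonal and $A,B$ are irreducible tridiagonal. Each of $A,B,C$ is then diagonalizable with one-dimensional eigenspaces. An ordering of the eigenvalues of $A$ is standard if corresponding eigenvectors, in that order, form a basis as in (i); similarly for $B$ with (ii) and $C$ with (iii). Standing assumptions: fix a nonzero $q\in\mathbb F$ with $q^4\ne 1$ and nonzero $a,b,c\in\mathbb F$ such that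 $q^{2i}\ne 1$ for $1\le i\le d$; none of $a^2,b^2,c^2$ is among $q^{2d-2},q^{2d-4},\ldots,q^{2-2d}$; none of $abc,a^{-1}bc,ab^{-1}c,abc^{-1}$ is among $q^{d-1},q^{d-3},\ldots,q^{1-d}$. For $0\le i\le d$ let $\theta_i=aq^{2i-d}+a^{-1}q^{d-2i}$, $\theta'_i=bq^{2i-d}+b^{-1}q^{d-2i}$, $\theta''_i=cq^{2i-d}+c^{-1}q^{d-2i}$. A Leonard triple $A,B,C$ on $V$ has $q$-Racah type with Huang data $(a,b,c,d)$ if $\{\theta_i\}_{i=0}^d$, $\{\theta'_i\}_{i=0}^d$, $\{\theta''_i\}_{i=0}^d$ are standard orderings of the eigenvalues of $A$, $B$, $C$ respectively, and $$A+\frac{qBC-q^{-1}CB}{q^2-q^{-2}}=\alpha_a I,\quad B+\frac{qCA-q^{-1}AC}{q^2-q^{-2}}=\alpha_b I,\quad C+\frac{qAB-q^{-1}BA}{q^2-q^{-2}}=\alpha_c I,$$ where $\alpha_a=\frac{(a+a^{-1})(q^{d+1}+q^{-d-1})+(b+b^{-1})(c+c^{-1})}{q+q^{-1}}$, $\alpha_b=\frac{(b+b^{-1})(q^{d+1}+q^{-d-1})+(c+c^{-1})(a+a^{-1})}{q+q^{-1}}$, $\alpha_c=\frac{(c+c^{-1})(q^{d+1}+q^{-d-1})+(a+a^{-1})(b+b^{-1})}{q+q^{-1}}$. For $0\le i\le d$ let $E_i$ (resp. $E'_i$, $E''_i$) be the primitive idempotent of $A$ (resp. $B$, $C$) for $\theta_i$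 (resp. $\theta'_i$, $\theta''_i$): the projection of $V$ onto that eigenspace that is zero on the other eigenspaces. Define $$W=\sum_{i=0}^d(-1)^ia^{-i}q^{i(d-i)}E_i,\quad W'=\sum_{i=0}^d(-1)^ib^{-i}q^{i(d-i)}E'_i,\quad W''=\sum_{i=0}^d(-1)^ic^{-i}q^{i(d-i)}E''_i.$$ *)

theory Defs
  imports Main "HOL.Vector_Spaces"
begin

text \<open>
  A square matrix of size d + 1 is a function of a row and a column index, of which only the
  entries with both indices in {..d} matter.
\<close>

definition diagonal_matrix :: "nat \<Rightarrow> (nat \<Rightarrow> nat \<Rightarrow> 'f::zero) \<Rightarrow> bool" where
  "diagonal_matrix d M \<longleftrightarrow> (\<forall>i\<le>d. \<forall>j\<le>d. M i j \<noteq> 0 \<longrightarrow> i = j)"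

definition tridiagonal_matrix :: "nat \<Rightarrow> (nat \<Rightarrow> nat \<Rightarrow> 'f::zero) \<Rightarrow> bool" where
  "tridiagonal_matrix d M \<longleftrightarrow>
     (\<forall>i\<le>d. \<forall>j\<le>d. M i j \<noteq> 0 \<longrightarrow> i = j \<or> i = Suc j \<or> j = Suc i)"

definition irreducible_tridiagonal_matrix :: "nat \<Rightarrow> (nat \<Rightarrow> nat \<Rightarrow> 'f::zero) \<Rightarrow> bool" where
  "irreducible_tridiagonal_matrix d M \<longleftrightarrow>
     tridiagonal_matrix d M \<and> (\<forall>i<d. M (Suc i) i \<noteq> 0 \<and> M i (Suc i) \<noteq> 0)"

text \<open>The sequences theta, theta' and theta'' are theta q d x for x = a, b, c.\<close>

definition theta :: "'f::field \<Rightarrow> nat \<Rightarrow> 'f \<Rightarrow> nat \<Rightarrow> 'f" where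
  "theta q d x i = x * q powi (2 * int i - int d) + inverse x * q powi (int d - 2 * int i)"

text \<open>The scalars of the three q-commutator relations are alpha q d applied to the cyclic
  shifts (a, b, c), (b, c, a) and (c, a, b).\<close>

definition alpha :: "'f::field \<Rightarrow> nat \<Rightarrow> 'f \<Rightarrow> 'f \<Rightarrow> 'f \<Rightarrow> 'f" where
  "alpha q d x y z =
     ((x + inverse x) * (q powi (int d + 1) + q powi (- int d - 1))
        + (y + inverse y) * (z + inverse z)) / (q + inverse q)"

context vector_space
begin

text \<open>The vector space is the whole type; End(V) is the set of linear functions on it, with
  composition as product.\<close>

definition End :: "('b \<Rightarrow> 'b) set" where
  "End = {X. Vector_Spaces.linear scale scale X}"

definition subalgebra :: "('b \<Rightarrow> 'b) set \<Rightarrow> bool" where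
  "subalgebra S \<longleftrightarrow> S \<subseteq> End \<and> id \<in> S
     \<and> (\<forall>X\<in>S. \<forall>Y\<in>S. (\<lambda>v. X v + Y v) \<in> S)
     \<and> (\<forall>k. \<forall>X\<in>S. (\<lambda>v. scale k (X v)) \<in> S)
     \<and> (\<forall>X\<in>S. \<forall>Y\<in>S. X \<circ> Y \<in> S)"

definition generated_subalgebra :: "('b \<Rightarrow> 'b) \<Rightarrow> ('b \<Rightarrow> 'b) set" where
  "generated_subalgebra X = subalgebra hull {X}"

definition ordered_basis :: "nat \<Rightarrow> (nat \<Rightarrow> 'b) \<Rightarrow> bool" where
  "ordered_basis d v \<longleftrightarrow>
     inj_on v {..d} \<and> independent (v ` {..d}) \<and> span (v ` {..d}) = UNIV"

definition represented_by :: "nat \<Rightarrow> (nat \<Rightarrow> 'b) \<Rightarrow> ('b \<Rightarrow> 'b) \<Rightarrow> (nat \<Rightarrow> nat \<Rightarrow> 'a) \<Rightarrow> bool" where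
  "represented_by d v X M \<longleftrightarrow> (\<forall>j\<le>d. X (v j) = (\<Sum>i\<le>d. scale (M i j) (v i)))"

definition leonard_basis ::
  "nat \<Rightarrow> (nat \<Rightarrow> 'b) \<Rightarrow> ('b \<Rightarrow> 'b) \<Rightarrow> ('b \<Rightarrow> 'b) \<Rightarrow> ('b \<Rightarrow> 'b) \<Rightarrow> bool" where
  "leonard_basis d v X Y Z \<longleftrightarrow> ordered_basis d v
     \<and> (\<exists>M. represented_by d v X M \<and> diagonal_matrix d M)
     \<and> (\<exists>M. represented_by d v Y M \<and> irreducible_tridiagonal_matrix d M)
     \<and> (\<exists>M. represented_by d v Z M \<and> irreducible_tridiagonal_matrix d M)"

definition leonard_triple ::
  "nat \<Rightarrow> ('b \<Rightarrow> 'b) \<Rightarrow> ('b \<Rightarrow> 'b) \<Rightarrow> ('b \<Rightarrow> 'b) \<Rightarrow> bool" where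
  "leonard_triple d A B C \<longleftrightarrow> A \<in> End \<and> B \<in> End \<and> C \<in> End
     \<and> (\<exists>v. leonard_basis d v A B C)
     \<and> (\<exists>v. leonard_basis d v B C A)
     \<and> (\<exists>v. leonard_basis d v C A B)"

definition eigenspace :: "('b \<Rightarrow> 'b) \<Rightarrow> 'a \<Rightarrow> 'b set" where
  "eigenspace X t = {v. X v = scale t v}"

definition eigenvalues :: "('b \<Rightarrow> 'b) \<Rightarrow> 'a set" where
  "eigenvalues X = {t. \<exists>v. v \<noteq> 0 \<and> v \<in> eigenspace X t}"

text \<open>A standard ordering of the eigenvalues of X, the first member of the (cyclically
  shifted) Leonard triple X, Y, Z. As the eigenspaces are one-dimensional, the choice of
  eigenvectors is immaterial.\<close>

definition standard_ordering ::
  "nat \<Rightarrow> (nat \<Rightarrow> 'a) \<Rightarrow> ('b \<Rightarrow> 'b) \<Rightarrow> ('b \<Rightarrow> 'b) \<Rightarrow> ('b \<Rightarrow> 'b) \<Rightarrow> bool" where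
  "standard_ordering d t X Y Z \<longleftrightarrow> bij_betw t {..d} (eigenvalues X)
     \<and> (\<exists>v. (\<forall>i\<le>d. v i \<in> eigenspace X (t i)) \<and> leonard_basis d v X Y Z)"

text \<open>The relation X + (q YZ - q^(-1) ZY) / (q^2 - q^(-2)) = k I.\<close>

definition q_relation ::
  "'a \<Rightarrow> 'a \<Rightarrow> ('b \<Rightarrow> 'b) \<Rightarrow> ('b \<Rightarrow> 'b) \<Rightarrow> ('b \<Rightarrow> 'b) \<Rightarrow> bool" where
  "q_relation q k X Y Z \<longleftrightarrow>
     (\<forall>v. X v + scale (1 / (q powi 2 - q powi (-2)))
                  (scale q (Y (Z v)) - scale (inverse q) (Z (Y v))) = scale k v)"

definition q_racah_huang_data ::
  "'a \<Rightarrow> 'a \<Rightarrow> 'a \<Rightarrow> 'a \<Rightarrow> nat \<Rightarrow> ('b \<Rightarrow> 'b) \<Rightarrow> ('b \<Rightarrow> 'b) \<Rightarrow> ('b \<Rightarrow> 'b) \<Rightarrow> bool" where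
  "q_racah_huang_data q a b c d A B C \<longleftrightarrow>
     standard_ordering d (theta q d a) A B C
     \<and> standard_ordering d (theta q d b) B C A
     \<and> standard_ordering d (theta q d c) C A B
     \<and> q_relation q (alpha q d a b c) A B C
     \<and> q_relation q (alpha q d b c a) B C A
     \<and> q_relation q (alpha q d c a b) C A B"

text \<open>For diagonalizable X the description determines the projection uniquely.\<close>

definition primitive_idempotent :: "('b \<Rightarrow> 'b) \<Rightarrow> 'a \<Rightarrow> 'b \<Rightarrow> 'b" where
  "primitive_idempotent X t =
     (THE E. E \<in> End \<and> E \<circ> E = E \<and> range E = eigenspace X t
        \<and> (\<forall>s. s \<noteq> t \<longrightarrow> (\<forall>v\<in>eigenspace X s. E v = 0)))"

text \<open>W, W' and W'' are W_map q d applied to (a, A), (b, B) and (c, C).\<close>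

definition W_map :: "'a \<Rightarrow> nat \<Rightarrow> 'a \<Rightarrow> ('b \<Rightarrow> 'b) \<Rightarrow> 'b \<Rightarrow> 'b" where
  "W_map q d x X = (\<lambda>v. \<Sum>i\<le>d. scale ((-1) ^ i * x powi (- int i) * q ^ (i * (d - i)))
                                 (primitive_idempotent X (theta q d x i) v))"

end

end

theory Submission
  imports Defs
begin

text \<open>
  Write \<open>S = A + B + C\<close> and \<open>[X, Y] = XY - YX\<close>, and look at an eigenbasis of \<open>A\<close> in which \<open>B\<close> and
  \<open>C\<close> are irreducible tridiagonal. Comparing entries off the diagonal, the relation that expresses
  \<open>B\<close> through \<open>qCA - q\<^sup>-\<^sup>1AC\<close> makes each entry of \<open>B\<close> next to the diagonal a known nonzero multiple
  of the entry of \<open>C\<close> in the same place: with \<open>y = a q\<^bsup>2i+1-d\<^esup>\<close> the factor is \<open>-1/y\<close> at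
  \<open>(i+1, i)\<close> and \<open>-y\<close> at \<open>(i, i+1)\<close>. Both claims follow from this.

  The subdiagonal entries of \<open>S\<close> are those of \<open>C\<close> times \<open>1 - 1/y\<close>, and \<open>y = 1\<close> would give \<open>a\<^sup>2\<close> one
  of the forbidden values. So \<open>S\<close> is tridiagonal with nonzero subdiagonal, hence has a cyclic vector,
  and a linear map with a cyclic vector has no centralizer beyond the algebra that it generates
  (\<open>S_centralizer\<close>).

  The coefficients of \<open>W\<close> satisfy \<open>w\<^sub>i = -y w\<^sub>i\<^sub>+\<^sub>1\<close>, with the same \<open>y\<close>. Entry by entry this gives the
  two conjugation formulas \<open>W S = (S + [A, B]/(q - q\<^sup>-\<^sup>1)) W\<close> and \<open>S W = W (S + [C, A]/(q - q\<^sup>-\<^sup>1))\<close>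
  (\<open>W_S\<close> and \<open>S_W\<close>). The cyclic shift \<open>A, B, C\<close> to \<open>B, C, A\<close> fixes \<open>S\<close> and turns the second formula
  into \<open>S W' = W' (S + [A, B]/(q - q\<^sup>-\<^sup>1))\<close>, with the same commutator as in the first. Therefore
  \<open>W' W S = W' (S + [A, B]/(q - q\<^sup>-\<^sup>1)) W = S W' W\<close>; so \<open>W' W\<close> commutes with \<open>S\<close> and lies in the
  algebra generated by \<open>S\<close>. The other two products are cyclic shifts of this one.
\<close>

section \<open>Subalgebras and coordinates\<close>

context vector_space
begin

lemma End_iff:
  "X \<in> End \<longleftrightarrow> (\<forall>u w. X (u + w) = X u + X w) \<and> (\<forall>k u. X (scale k u) = scale k (X u))"
  by (simp add: End_def Vector_Spaces.linear_iff vector_space_axioms)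

lemma End_add: "X \<in> End \<Longrightarrow> X (u + w) = X u + X w"
  by (simp add: End_iff)

lemma End_scale: "X \<in> End \<Longrightarrow> X (scale k u) = scale k (X u)"
  by (simp add: End_iff)

lemma End_sum: "X \<in> End \<Longrightarrow> X (\<Sum>i\<in>I. f i) = (\<Sum>i\<in>I. X (f i))"
  unfolding End_def by (auto simp: linear_iff_module_hom intro: module_hom.sum)

lemma End_diff: "X \<in> End \<Longrightarrow> X (u - w) = X u - X w"
  unfolding End_def by (auto simp: linear_iff_module_hom intro: module_hom.diff)

lemma subalgebra_End: "subalgebra End"
  by (auto simp: subalgebra_def End_iff scale_right_distrib algebra_simps)

lemma subalgebra_generated:
  assumes "X \<in> End" shows "subalgebra (generated_subalgebra X)"
proof -
  have *: "generated_subalgebra X = \<Inter>{S. subalgebra S \<and> X \<in> S}"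
    by (simp add: generated_subalgebra_def hull_def)
  have "generated_subalgebra X \<subseteq> End"
    using subalgebra_End assms unfolding * by blast
  then show ?thesis
    unfolding subalgebra_def by (auto simp: * subalgebra_def)
qed

text \<open>The linear maps that commute with \<open>Y\<close> form a subalgebra, which contains \<open>X\<close>.\<close>

lemma generated_subalgebra_commutes:
  assumes X: "X \<in> End" and Y: "Y \<in> End" and YX: "Y \<circ> X = X \<circ> Y"
    and P: "P \<in> generated_subalgebra X"
  shows "Y (P u) = P (Y u)"
proof -
  have "subalgebra {Q \<in> End. \<forall>u. Y (Q u) = Q (Y u)}"
    using subalgebra_End Y unfolding subalgebra_def
    by (auto simp: End_add End_scale)
  moreover have "\<forall>u. Y (X u) = X (Y u)"
    using YX by (simp add: fun_eq_iff)
  ultimately have "generated_subalgebra X \<subseteq> {Q \<in> End. \<forall>u. Y (Q u) = Q (Y u)}"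
    using X unfolding generated_subalgebra_def by (intro hull_minimal) auto
  then show ?thesis using P by blast
qed

text \<open>If \<open>X\<close> has a cyclic vector \<open>w\<close>, a linear map that commutes with \<open>X\<close> is determined by its
  value at \<open>w\<close>; some element of the algebra generated by \<open>X\<close> takes that value, and it commutes
  with \<open>X\<close> too.\<close>

lemma cyclic_vector_centralizer:
  assumes X: "X \<in> End" and cyclic: "\<And>u. \<exists>P \<in> generated_subalgebra X. u = P w"
    and Y: "Y \<in> End" and YX: "Y \<circ> X = X \<circ> Y"
  shows "Y \<in> generated_subalgebra X"
proof -
  have End: "P \<in> End" if "P \<in> generated_subalgebra X" for P
    using subalgebra_generated[OF X] that by (auto simp: subalgebra_def)
  obtain Q where Q: "Q \<in> generated_subalgebra X" "Y w = Q w"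
    using cyclic by blast
  have QX: "Q \<circ> X = X \<circ> Q"
    using generated_subalgebra_commutes[OF X X refl Q(1)] by (simp add: fun_eq_iff)
  have "Y u = Q u" for u
  proof -
    obtain P where P: "P \<in> generated_subalgebra X" "u = P w"
      using cyclic by blast
    show ?thesis
      using generated_subalgebra_commutes[OF X Y YX P(1)]
        generated_subalgebra_commutes[OF X End[OF Q(1)] QX P(1)] P(2) Q(2) by simp
  qed
  then have "Y = Q" by (simp add: fun_eq_iff)
  then show ?thesis using Q(1) by simp
qed

definition coordinate :: "nat \<Rightarrow> (nat \<Rightarrow> 'b) \<Rightarrow> nat \<Rightarrow> 'b \<Rightarrow> 'a" where
  "coordinate d v i u = representation (v ` {..d}) u (v i)"

lemma coordinate_linear:
  assumes "ordered_basis d v"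
  shows "coordinate d v i (u + w) = coordinate d v i u + coordinate d v i w"
    and "coordinate d v i (u - w) = coordinate d v i u - coordinate d v i w"
    and "coordinate d v i (scale k u) = k * coordinate d v i u"
    and "coordinate d v i (\<Sum>j\<in>I. f j) = (\<Sum>j\<in>I. coordinate d v i (f j))"
  using assms
  by (auto simp: coordinate_def ordered_basis_def representation_add representation_diff
      representation_scale representation_sum)

lemma coordinate_basis:
  assumes "ordered_basis d v" "i \<le> d" "j \<le> d"
  shows "coordinate d v i (v j) = (if i = j then 1 else 0)"
  using assms
  by (auto simp: coordinate_def ordered_basis_def representation_basis dest: inj_onD)

lemma coordinate_expansion:
  assumes "ordered_basis d v"
  shows "u = (\<Sum>i\<le>d. scale (coordinate d v i u) (v i))"
proof -
  have "u = (\<Sum>b\<in>v ` {..d}. scale (representation (v ` {..d}) u b) b)"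
    using assms by (subst sum_representation_eq) (auto simp: ordered_basis_def)
  also have "\<dots> = (\<Sum>i\<le>d. scale (coordinate d v i u) (v i))"
    using assms by (subst sum.reindex) (auto simp: ordered_basis_def coordinate_def)
  finally show ?thesis .
qed

lemma coordinate_eqI:
  assumes "ordered_basis d v" "\<And>i. i \<le> d \<Longrightarrow> coordinate d v i u = coordinate d v i w"
  shows "u = w"
  using assms by (subst (1 2) coordinate_expansion[OF assms(1)]) simp

lemma End_eqI:
  assumes v: "ordered_basis d v" and X: "X \<in> End" and Y: "Y \<in> End"
    and eq: "\<And>j. j \<le> d \<Longrightarrow> X (v j) = Y (v j)"
  shows "X = Y"
proof
  fix u
  show "X u = Y u"
    using X Y eq by (subst (1 2) coordinate_expansion[OF v]) (simp add: End_sum End_scale)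
qed

lemma coordinate_represented:
  assumes "ordered_basis d v" "represented_by d v X M" "i \<le> d" "j \<le> d"
  shows "coordinate d v i (X (v j)) = M i j"
  using assms
  by (simp add: represented_by_def coordinate_linear coordinate_basis if_distrib cong: if_cong)

text \<open>Each step along a Hessenberg matrix with nonzero subdiagonal produces the next basis vector
  up to a combination of the previous ones, so the first basis vector is cyclic.\<close>

lemma hessenberg_centralizer:
  assumes v: "ordered_basis d v" and X: "X \<in> End"
    and sub: "\<And>j. j < d \<Longrightarrow> coordinate d v (Suc j) (X (v j)) \<noteq> 0"
    and below: "\<And>i j. i \<le> d \<Longrightarrow> Suc j < i \<Longrightarrow> coordinate d v i (X (v j)) = 0"
    and Y: "Y \<in> End" and YX: "Y \<circ> X = X \<circ> Y"
  shows "Y \<in> generated_subalgebra X"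
proof -
  define U where "U = {P (v 0) | P. P \<in> generated_subalgebra X}"
  have alg: "subalgebra (generated_subalgebra X)"
    using X by (rule subalgebra_generated)
  have XG: "X \<in> generated_subalgebra X"
    by (simp add: generated_subalgebra_def hull_inc)
  have UI: "P (v 0) \<in> U" if "P \<in> generated_subalgebra X" for P
    using that by (auto simp: U_def)
  have UE: "\<exists>P \<in> generated_subalgebra X. u = P (v 0)" if "u \<in> U" for u
    using that by (auto simp: U_def)
  have U0: "v 0 \<in> U"
    using alg UI[of id] by (simp add: subalgebra_def)
  have Uadd: "u + w \<in> U" if u: "u \<in> U" and w: "w \<in> U" for u w
  proof -
    obtain P Q where "P \<in> generated_subalgebra X" "Q \<in> generated_subalgebra X"
      "u = P (v 0)" "w = Q (v 0)"
      using UE[OF u] UE[OF w] by blast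
    then show ?thesis
      using alg UI[of "\<lambda>z. P z + Q z"] by (simp add: subalgebra_def)
  qed
  have Uscale: "scale k u \<in> U" if u: "u \<in> U" for k u
  proof -
    obtain P where "P \<in> generated_subalgebra X" "u = P (v 0)" using UE[OF u] by blast
    then show ?thesis
      using alg UI[of "\<lambda>z. scale k (P z)"] by (simp add: subalgebra_def)
  qed
  have UX: "X u \<in> U" if u: "u \<in> U" for u
  proof -
    obtain P where "P \<in> generated_subalgebra X" "u = P (v 0)" using UE[OF u] by blast
    then show ?thesis
      using alg XG UI[of "X \<circ> P"] by (simp add: subalgebra_def)
  qed
  have U: "subspace U"
    using U0 Uscale[OF U0, of 0] Uadd Uscale by (auto simp: subspace_def)
  have vU: "i \<le> d \<Longrightarrow> v i \<in> U" for i
  proof (induction i rule: less_induct)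
    case (less i)
    show ?case
    proof (cases i)
      case 0 then show ?thesis using U0 by simp
    next
      case (Suc j)
      let ?x = "\<lambda>i. coordinate d v i (X (v j))"
      have j: "j < d" "Suc j \<le> d" using less.prems Suc by auto
      have "X (v j) = (\<Sum>i\<le>d. scale (?x i) (v i))"
        by (rule coordinate_expansion[OF v])
      also have "\<dots> = (\<Sum>i\<le>Suc j. scale (?x i) (v i))"
        using j below by (intro sum.mono_neutral_right) (auto simp: not_le)
      finally have "X (v j) = (\<Sum>i\<le>j. scale (?x i) (v i)) + scale (?x (Suc j)) (v (Suc j))"
        by simp
      then have "scale (?x (Suc j)) (v (Suc j)) = X (v j) - (\<Sum>i\<le>j. scale (?x i) (v i))"
        by (metis add_diff_cancel_left')
      also have "\<dots> \<in> U"
        using less Suc j UX by (intro subspace_diff[OF U] subspace_sum[OF U] Uscale) auto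
      finally have "scale (inverse (?x (Suc j))) (scale (?x (Suc j)) (v (Suc j))) \<in> U"
        by (rule Uscale)
      then show ?thesis using sub[OF j(1)] Suc by simp
    qed
  qed
  have "u \<in> U" for u
    by (subst coordinate_expansion[OF v]) (intro subspace_sum[OF U] Uscale vU, simp)
  then show ?thesis
    by (intro cyclic_vector_centralizer[OF X _ Y YX, of "v 0"]) (auto simp: U_def)
qed

lemma coordinate_eigenbasis:
  assumes v: "ordered_basis d v" and X: "X \<in> End"
    and eig: "\<And>i. i \<le> d \<Longrightarrow> X (v i) = scale (t i) (v i)" and i: "i \<le> d"
  shows "coordinate d v i (X u) = t i * coordinate d v i u"
  using X i
  by (subst coordinate_expansion[OF v, of u])
    (simp add: End_sum End_scale eig coordinate_linear[OF v] coordinate_basis[OF v]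
      if_distrib[of "\<lambda>z. _ * z"] cong: if_cong)

text \<open>Because the scalars \<open>t i\<close> are distinct, the eigenspace for \<open>t i\<close> is the line through \<open>v i\<close>
  and the other eigenspaces have zero \<open>i\<close>-th coordinate, so the projection along the basis meets
  the description of the primitive idempotent; any map that meets it takes the same values on the
  basis.\<close>

lemma primitive_idempotent_eq:
  assumes v: "ordered_basis d v" and X: "X \<in> End"
    and eig: "\<And>i. i \<le> d \<Longrightarrow> X (v i) = scale (t i) (v i)"
    and inj: "inj_on t {..d}" and i: "i \<le> d"
  shows "primitive_idempotent X (t i) = (\<lambda>u. scale (coordinate d v i u) (v i))"
    (is "_ = ?E")
proof -
  have E: "?E \<in> End"
    by (simp add: End_iff coordinate_linear[OF v] scale_left_distrib)
  have zero: "coordinate d v j u = 0" if "u \<in> eigenspace X s" "j \<le> d" "s \<noteq> t j" for u s j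
    using coordinate_eigenbasis[of d v X t j u, OF v X eig that(2)] that by (simp add: eigenspace_def coordinate_linear[OF v])
  have eigE: "?E u = u" if u: "u \<in> eigenspace X (t i)" for u
  proof (rule coordinate_eqI[OF v])
    fix j assume j: "j \<le> d"
    show "coordinate d v j (?E u) = coordinate d v j u"
      using zero[OF u j] inj i j
      by (auto simp: coordinate_linear[OF v] coordinate_basis[OF v] inj_on_eq_iff)
  qed
  have vi: "v j \<in> eigenspace X (t j)" if "j \<le> d" for j
    using eig that by (simp add: eigenspace_def)
  have range: "range ?E = eigenspace X (t i)"
  proof
    show "range ?E \<subseteq> eigenspace X (t i)"
      using i by (auto simp: eigenspace_def End_scale[OF X] eig scale_left_commute)
    show "eigenspace X (t i) \<subseteq> range ?E"
      by (intro subsetI range_eqI) (rule eigE[symmetric])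
  qed
  show ?thesis
    unfolding primitive_idempotent_def
  proof (rule the_equality)
    have "?E \<circ> ?E = ?E"
    proof
      fix u
      have "?E u \<in> eigenspace X (t i)" using range by blast
      then show "(?E \<circ> ?E) u = ?E u" unfolding comp_apply by (rule eigE)
    qed
    then show "?E \<in> End \<and> ?E \<circ> ?E = ?E \<and> range ?E = eigenspace X (t i)
        \<and> (\<forall>s. s \<noteq> t i \<longrightarrow> (\<forall>u\<in>eigenspace X s. ?E u = 0))"
      using E range zero i by simp
  next
    fix F assume F: "F \<in> End \<and> F \<circ> F = F \<and> range F = eigenspace X (t i)
        \<and> (\<forall>s. s \<noteq> t i \<longrightarrow> (\<forall>u\<in>eigenspace X s. F u = 0))"
    have "F (v j) = ?E (v j)" if j: "j \<le> d" for j
    proof (cases "j = i")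
      case True
      then obtain u where "v i = F u" using F vi[OF i] by (metis rangeE)
      then have "F (v i) = v i" using F by (metis comp_apply)
      then show ?thesis using True i by (simp add: coordinate_basis[OF v])
    next
      case False
      then have "t j \<noteq> t i" using inj i j by (simp add: inj_on_eq_iff)
      then show ?thesis using F vi[OF j] False i j by (simp add: coordinate_basis[OF v])
    qed
    then show "F = ?E" using F E by (intro End_eqI[OF v]) auto
  qed
qed

end

section \<open>Consecutive eigenvalues and coefficients of W\<close>

definition W_coeff :: "'f::field \<Rightarrow> nat \<Rightarrow> 'f \<Rightarrow> nat \<Rightarrow> 'f" where
  "W_coeff q d x i = (-1) ^ i * x powi (- int i) * q ^ (i * (d - i))"

text \<open>Write \<open>f z = z + 1/z\<close>. Then \<open>theta\<close> at \<open>i\<close> and \<open>i + 1\<close> is \<open>f (y/q)\<close> and \<open>f (y q)\<close>, where \<open>y\<close> is the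
  following scalar. The ratio of two consecutive coefficients of \<open>W\<close> depends on \<open>y\<close> alone as well,
  which is why the conjugation formulas below come out so simply.\<close>

definition midpoint :: "'f::field \<Rightarrow> nat \<Rightarrow> 'f \<Rightarrow> nat \<Rightarrow> 'f" where
  "midpoint q d x i = x * q powi (2 * int i + 1 - int d)"

lemma midpoint_nonzero: "q \<noteq> 0 \<Longrightarrow> x \<noteq> 0 \<Longrightarrow> midpoint q d x i \<noteq> 0"
  by (simp add: midpoint_def)

lemma theta_midpoint:
  fixes q x :: "'f::field" and d i :: nat
  assumes "q \<noteq> 0" "x \<noteq> 0"
  defines "y \<equiv> midpoint q d x i"
  shows "theta q d x i = y * inverse q + inverse y * q"
    and "theta q d x (Suc i) = y * q + inverse y * inverse q"
proof -
  have 1: "q powi (2 * int i - int d) = q powi (2 * int i + 1 - int d) * inverse q"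
    using power_int_add[of q "2 * int i + 1 - int d" "-1"] assms(1) by (simp add: power_int_minus)
  have 2: "q powi (2 * int (Suc i) - int d) = q powi (2 * int i + 1 - int d) * q"
    using power_int_add[of q "2 * int i + 1 - int d" "1"] assms(1) by (simp add: algebra_simps)
  have 3: "q powi (int d - n) = inverse (q powi (n - int d))" for n
    by (metis minus_diff_eq power_int_minus)
  show "theta q d x i = y * inverse q + inverse y * q"
    using assms(1,2) unfolding theta_def 3 1 by (simp add: y_def midpoint_def)
  show "theta q d x (Suc i) = y * q + inverse y * inverse q"
    using assms(1,2) unfolding theta_def 3 2 by (simp add: y_def midpoint_def)
qed

lemma W_coeff_step:
  fixes q x :: "'f::field"
  assumes "q \<noteq> 0" "x \<noteq> 0" "i < d"
  shows "W_coeff q d x i = - midpoint q d x i * W_coeff q d x (Suc i)"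
proof -
  have x: "x powi (- int i) = x * x powi (- int (Suc i))"
    using power_int_add[of x 1 "- int (Suc i)"] assms(2) by simp
  have "q ^ (i * (d - i)) = q powi (int (i * (d - i)))" by (simp only: power_int_of_nat)
  also have "int (i * (d - i)) = (2 * int i + 1 - int d) + int (Suc i * (d - Suc i))"
  proof -
    \<comment> \<open>Naming \<open>d - Suc i\<close> removes the truncated subtractions.\<close>
    obtain e where "d = Suc i + e"
      using assms(3) by (metis Suc_leI le_Suc_ex)
    then show ?thesis by (simp add: algebra_simps)
  qed
  also have "q powi \<dots> = q powi (2 * int i + 1 - int d) * q ^ (Suc i * (d - Suc i))"
    using assms(1) by (subst power_int_add) (auto simp del: of_nat_mult mult_Suc simp: power_int_of_nat)
  finally have q: "q ^ (i * (d - i)) = q powi (2 * int i + 1 - int d) * q ^ (Suc i * (d - Suc i))" .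
  show ?thesis
    unfolding W_coeff_def x q by (simp add: midpoint_def del: mult_Suc)
qed

section \<open>Conjugation by W\<close>

text \<open>The part of the hypotheses that concerns one of the three eigenbases, stated for a triple
  \<open>X, Y, Z\<close> that may be any cyclic shift of \<open>A, B, C\<close>.\<close>

locale q_racah_eigenbasis = vector_space scale
  for scale :: "'a::field \<Rightarrow> 'b::ab_group_add \<Rightarrow> 'b" +
  fixes q x k :: 'a and d :: nat and v :: "nat \<Rightarrow> 'b" and X Y Z :: "'b \<Rightarrow> 'b"
  assumes q_nonzero: "q \<noteq> 0" and q_power4: "q ^ 4 \<noteq> 1" and x_nonzero: "x \<noteq> 0"
    and X_End: "X \<in> End" and Y_End: "Y \<in> End" and Z_End: "Z \<in> End"
    and inj_theta: "inj_on (theta q d x) {..d}"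
    and eigenvector: "\<And>i. i \<le> d \<Longrightarrow> X (v i) = scale (theta q d x i) (v i)"
    and leonard: "leonard_basis d v X Y Z"
    and relation: "q_relation q k Y Z X"
begin

lemma basis: "ordered_basis d v"
  using leonard by (simp add: leonard_basis_def)

abbreviation entry :: "('b \<Rightarrow> 'b) \<Rightarrow> nat \<Rightarrow> nat \<Rightarrow> 'a" where
  "entry T i j \<equiv> coordinate d v i (T (v j))"

lemma coordinate_X: "i \<le> d \<Longrightarrow> coordinate d v i (X u) = theta q d x i * coordinate d v i u"
  by (rule coordinate_eigenbasis[OF basis X_End eigenvector])

lemma W_map_expansion:
  "W_map q d x X u = (\<Sum>i\<le>d. scale (W_coeff q d x i * coordinate d v i u) (v i))"
  using primitive_idempotent_eq[OF basis X_End eigenvector inj_theta]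
  by (simp add: W_map_def W_coeff_def)

lemma W_map_End: "W_map q d x X \<in> End"
  by (simp add: End_iff W_map_expansion coordinate_linear[OF basis] distrib_left scale_left_distrib
      sum.distrib scale_sum_right mult.left_commute)

lemma coordinate_W_map:
  "i \<le> d \<Longrightarrow> coordinate d v i (W_map q d x X u) = W_coeff q d x i * coordinate d v i u"
  by (simp add: W_map_expansion coordinate_linear[OF basis] coordinate_basis[OF basis]
      if_distrib[of "\<lambda>z. _ * z"] cong: if_cong)

lemma W_map_basis: "j \<le> d \<Longrightarrow> W_map q d x X (v j) = scale (W_coeff q d x j) (v j)"
  by (rule coordinate_eqI[OF basis])
    (simp add: coordinate_W_map coordinate_linear[OF basis] coordinate_basis[OF basis])

lemma entry_tridiagonal:
  assumes "i \<le> d" "j \<le> d" "i \<noteq> j" "i \<noteq> Suc j" "j \<noteq> Suc i"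
  shows "entry Y i j = 0" "entry Z i j = 0"
proof -
  have *: "entry T i j = 0"
    if "represented_by d v T M" "irreducible_tridiagonal_matrix d M" for T M
    using that assms coordinate_represented[OF basis that(1) assms(1,2)]
    by (auto simp: irreducible_tridiagonal_matrix_def tridiagonal_matrix_def)
  show "entry Y i j = 0" "entry Z i j = 0"
    using leonard * by (auto simp: leonard_basis_def)
qed

lemma entry_subdiagonal: "i < d \<Longrightarrow> entry Z (Suc i) i \<noteq> 0"
  using leonard coordinate_represented[OF basis]
  by (auto simp: leonard_basis_def irreducible_tridiagonal_matrix_def)

lemma q_denominators: "q powi 2 - q powi (-2) = q ^ 2 - inverse (q ^ 2)" "q ^ 2 - inverse (q ^ 2) \<noteq> 0"
  "q - inverse q \<noteq> 0"
proof -
  show "q powi 2 - q powi (-2) = q ^ 2 - inverse (q ^ 2)"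
    by (simp add: power_int_minus)
  show *: "q ^ 2 - inverse (q ^ 2) \<noteq> 0"
  proof
    assume "q ^ 2 - inverse (q ^ 2) = 0"
    then have "q ^ 2 * q ^ 2 = 1" using q_nonzero by (simp add: field_simps)
    then show False using q_power4 by (simp flip: power_add)
  qed
  have "q ^ 2 - inverse (q ^ 2) = (q - inverse q) * (q + inverse q)"
    by (simp add: algebra_simps power2_eq_square)
  then show "q - inverse q \<noteq> 0" using * by auto
qed

text \<open>In the eigenbasis of \<open>X\<close> multiplication by \<open>X\<close> scales rows and columns by eigenvalues, so the
  relation for \<open>Y\<close> couples only entries in the same place, and its scalar term \<open>k\<close> lives on the
  diagonal.\<close>

lemma entry_relation:
  assumes "i \<le> d" "j \<le> d" "i \<noteq> j"
  shows "(q ^ 2 - inverse (q ^ 2)) * entry Y i j =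
    - (q * theta q d x j - inverse q * theta q d x i) * entry Z i j"
proof -
  have "coordinate d v i (Y (v j) + scale (1 / (q powi 2 - q powi (-2)))
      (scale q (Z (X (v j))) - scale (inverse q) (X (Z (v j))))) = coordinate d v i (scale k (v j))"
    using relation by (simp add: q_relation_def)
  then have "entry Y i j + 1 / (q ^ 2 - inverse (q ^ 2)) *
      (q * theta q d x j * entry Z i j - inverse q * theta q d x i * entry Z i j) = 0"
    unfolding q_denominators(1) using assms
    by (simp add: coordinate_linear[OF basis] coordinate_X eigenvector End_scale[OF Z_End]
        coordinate_basis[OF basis] mult.assoc)
  then show ?thesis using q_denominators(2) by (simp add: field_simps)
qed

text \<open>At neighbouring indices one of the two terms of \<open>q \<theta>\<^sub>j - q\<^sup>-\<^sup>1 \<theta>\<^sub>i\<close> cancels, and what is left is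
  \<open>q\<^sup>2 - q\<^sup>-\<^sup>2\<close> times \<open>y\<close> or \<open>1/y\<close>.\<close>

lemma entry_Y:
  assumes "i < d"
  shows "entry Y (Suc i) i = - inverse (midpoint q d x i) * entry Z (Suc i) i"
    and "entry Y i (Suc i) = - midpoint q d x i * entry Z i (Suc i)"
proof -
  let ?y = "midpoint q d x i" and ?k = "q ^ 2 - inverse (q ^ 2)"
  note th = theta_midpoint[OF q_nonzero x_nonzero, of d i]
  have i: "i \<le> d" "Suc i \<le> d" using assms by auto
  have e1: "q * theta q d x i - inverse q * theta q d x (Suc i) = ?k * inverse ?y"
    unfolding th using q_nonzero by (simp add: algebra_simps power2_eq_square)
  have e2: "q * theta q d x (Suc i) - inverse q * theta q d x i = ?k * ?y"
    unfolding th using q_nonzero by (simp add: algebra_simps power2_eq_square)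
  have "?k * entry Y (Suc i) i = - (?k * inverse ?y) * entry Z (Suc i) i"
    using entry_relation[OF i(2,1), unfolded e1] by simp
  also have "\<dots> = ?k * (- inverse ?y * entry Z (Suc i) i)" by simp
  finally show "entry Y (Suc i) i = - inverse ?y * entry Z (Suc i) i"
    using q_denominators(2) by (metis mult_cancel_left)
  have "?k * entry Y i (Suc i) = - (?k * ?y) * entry Z i (Suc i)"
    using entry_relation[OF i, unfolded e2] by simp
  also have "\<dots> = ?k * (- ?y * entry Z i (Suc i))" by simp
  finally show "entry Y i (Suc i) = - ?y * entry Z i (Suc i)"
    using q_denominators(2) by (metis mult_cancel_left)
qed

lemma theta_gap:
  "theta q d x (Suc i) - theta q d x i =
    (q - inverse q) * (midpoint q d x i - inverse (midpoint q d x i))"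
  unfolding theta_midpoint[OF q_nonzero x_nonzero, of d i] by (simp add: algebra_simps)

text \<open>These are the matrix entries of the two conjugation formulas. On the diagonal both sides vanish,
  away from the three central diagonals all entries vanish, and next to the diagonal the
  equations come down to \<open>y - 1/y = (1 + y) (1 - 1/y)\<close>: the left side is the gap between the two
  eigenvalues over \<open>q - q\<^sup>-\<^sup>1\<close>, the factors on the right come from \<open>W\<close> and from \<open>Y + Z\<close>.\<close>

lemma entry_W:
  assumes i: "i \<le> d" and j: "j \<le> d"
  shows "(W_coeff q d x i - W_coeff q d x j) * (entry Y i j + entry Z i j) =
      W_coeff q d x j * (1 / (q - inverse q) * ((theta q d x i - theta q d x j) * entry Y i j))" (is ?L)
    and "(W_coeff q d x j - W_coeff q d x i) * (entry Y i j + entry Z i j) =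
      W_coeff q d x i * (1 / (q - inverse q) * ((theta q d x j - theta q d x i) * entry Z i j))" (is ?R)
proof -
  have cancel: "1 / (q - inverse q) * ((q - inverse q) * r * s) = r * s" for r s
    using q_denominators(3) by (simp add: mult.assoc)
  consider "i = j" | "i = Suc j" | "j = Suc i" | "i \<noteq> j" "i \<noteq> Suc j" "j \<noteq> Suc i" by blast
  then have "?L \<and> ?R"
  proof cases
    case 1 then show ?thesis by simp
  next
    case 2
    then have "j < d" using i by simp
    note s = W_coeff_step[OF q_nonzero x_nonzero this] entry_Y(1)[OF this]
    have y: "midpoint q d x j * inverse (midpoint q d x j) = 1"
      by (simp add: midpoint_nonzero q_nonzero x_nonzero)
    have g': "theta q d x j - theta q d x (Suc j) =
      (q - inverse q) * (inverse (midpoint q d x j) - midpoint q d x j)"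
      using theta_gap[of j] by (simp add: algebra_simps)
    show ?thesis unfolding 2 theta_gap g' s cancel using y by algebra
  next
    case 3
    then have "i < d" using j by simp
    note s = W_coeff_step[OF q_nonzero x_nonzero this] entry_Y(2)[OF this]
    have y: "midpoint q d x i * inverse (midpoint q d x i) = 1"
      by (simp add: midpoint_nonzero q_nonzero x_nonzero)
    have g': "theta q d x i - theta q d x (Suc i) =
      (q - inverse q) * (inverse (midpoint q d x i) - midpoint q d x i)"
      using theta_gap[of i] by (simp add: algebra_simps)
    show ?thesis unfolding 3 theta_gap g' s cancel using y by algebra
  next
    case 4 then show ?thesis using entry_tridiagonal[OF i j] by simp
  qed
  then show ?L ?R by auto
qed

abbreviation S :: "'b \<Rightarrow> 'b" where "S u \<equiv> X u + Y u + Z u"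

text \<open>As \<open>W\<close> and \<open>X\<close> are both diagonal here, the \<open>X\<close> part of the sum commutes with \<open>W\<close>, and the
  off-diagonal parts of \<open>Y\<close> and \<open>Z\<close> are handled by the entries above.\<close>

lemma W_S:
  "W_map q d x X (S u) =
    S (W_map q d x X u) + scale (1 / (q - inverse q))
      (X (Y (W_map q d x X u)) - Y (X (W_map q d x X u)))"
proof -
  let ?W = "W_map q d x X"
  note lin = End_add[OF X_End] End_add[OF Y_End] End_add[OF Z_End] End_add[OF W_map_End]
    End_scale[OF X_End] End_scale[OF Y_End] End_scale[OF Z_End] End_scale[OF W_map_End]
  have "(\<lambda>u. ?W (S u)) = (\<lambda>u. S (?W u) + scale (1 / (q - inverse q)) (X (Y (?W u)) - Y (X (?W u))))"
  proof (rule End_eqI[OF basis])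
    show "(\<lambda>u. ?W (S u)) \<in> End"
      by (simp add: End_iff lin algebra_simps)
    show "(\<lambda>u. S (?W u) + scale (1 / (q - inverse q)) (X (Y (?W u)) - Y (X (?W u)))) \<in> End"
      by (simp add: End_iff lin algebra_simps)
    fix j assume j: "j \<le> d"
    show "?W (S (v j)) = S (?W (v j)) + scale (1 / (q - inverse q)) (X (Y (?W (v j))) - Y (X (?W (v j))))"
    proof (rule coordinate_eqI[OF basis])
      fix i assume i: "i \<le> d"
      let ?c = "1 / (q - inverse q) * ((theta q d x i - theta q d x j) * entry Y i j)"
      have "coordinate d v i (?W (S (v j))) = W_coeff q d x i * entry X i j + W_coeff q d x i * (entry Y i j + entry Z i j)"
        using i by (simp add: coordinate_W_map coordinate_linear[OF basis] algebra_simps)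
      also have "W_coeff q d x i * entry X i j = W_coeff q d x j * entry X i j"
        using i j by (simp add: coordinate_X coordinate_basis[OF basis])
      also have "W_coeff q d x i * (entry Y i j + entry Z i j) =
          W_coeff q d x j * (entry Y i j + entry Z i j) + W_coeff q d x j * ?c"
        using entry_W(1)[OF i j] by (simp only: left_diff_distrib diff_eq_eq add.commute)
      also have "W_coeff q d x j * entry X i j + \<dots> = coordinate d v i
          (S (?W (v j)) + scale (1 / (q - inverse q)) (X (Y (?W (v j))) - Y (X (?W (v j)))))"
        using i j by (simp add: W_map_basis lin coordinate_linear[OF basis] coordinate_X eigenvector
            algebra_simps)
      finally show "coordinate d v i (?W (S (v j))) = coordinate d v i
          (S (?W (v j)) + scale (1 / (q - inverse q)) (X (Y (?W (v j))) - Y (X (?W (v j)))))" .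
    qed
  qed
  then show ?thesis by (rule fun_cong)
qed

lemma S_W:
  "S (W_map q d x X u) =
    W_map q d x X (S u + scale (1 / (q - inverse q)) (Z (X u) - X (Z u)))"
proof -
  let ?W = "W_map q d x X"
  note lin = End_add[OF X_End] End_add[OF Y_End] End_add[OF Z_End] End_add[OF W_map_End]
    End_scale[OF X_End] End_scale[OF Y_End] End_scale[OF Z_End] End_scale[OF W_map_End]
  have "(\<lambda>u. S (?W u)) = (\<lambda>u. ?W (S u + scale (1 / (q - inverse q)) (Z (X u) - X (Z u))))"
  proof (rule End_eqI[OF basis])
    show "(\<lambda>u. S (?W u)) \<in> End"
      by (simp add: End_iff lin algebra_simps)
    show "(\<lambda>u. ?W (S u + scale (1 / (q - inverse q)) (Z (X u) - X (Z u)))) \<in> End"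
      by (simp add: End_iff lin End_diff[OF W_map_End] algebra_simps)
    fix j assume j: "j \<le> d"
    show "S (?W (v j)) = ?W (S (v j) + scale (1 / (q - inverse q)) (Z (X (v j)) - X (Z (v j))))"
    proof (rule coordinate_eqI[OF basis])
      fix i assume i: "i \<le> d"
      let ?c = "1 / (q - inverse q) * ((theta q d x j - theta q d x i) * entry Z i j)"
      have "coordinate d v i (S (?W (v j))) = W_coeff q d x j * entry X i j + W_coeff q d x j * (entry Y i j + entry Z i j)"
        using j by (simp add: W_map_basis lin coordinate_linear[OF basis] algebra_simps)
      also have "W_coeff q d x j * entry X i j = W_coeff q d x i * entry X i j"
        using i j by (simp add: coordinate_X coordinate_basis[OF basis])
      also have "W_coeff q d x j * (entry Y i j + entry Z i j) =
          W_coeff q d x i * (entry Y i j + entry Z i j) + W_coeff q d x i * ?c"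
        using entry_W(2)[OF i j] by (simp only: left_diff_distrib diff_eq_eq add.commute)
      also have "W_coeff q d x i * entry X i j + \<dots> = coordinate d v i
          (?W (S (v j) + scale (1 / (q - inverse q)) (Z (X (v j)) - X (Z (v j)))))"
        using i j by (simp add: coordinate_W_map lin coordinate_linear[OF basis] coordinate_X eigenvector
            algebra_simps)
      finally show "coordinate d v i (S (?W (v j))) = coordinate d v i
          (?W (S (v j) + scale (1 / (q - inverse q)) (Z (X (v j)) - X (Z (v j)))))" .
    qed
  qed
  then show ?thesis by (rule fun_cong)
qed

lemma S_End: "S \<in> End"
  by (simp add: End_iff End_add[OF X_End] End_add[OF Y_End] End_add[OF Z_End]
      End_scale[OF X_End] End_scale[OF Y_End] End_scale[OF Z_End] algebra_simps)

lemma S_centralizer: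
  assumes mid: "\<And>i. i < d \<Longrightarrow> midpoint q d x i \<noteq> 1"
    and T: "T \<in> End" and TS: "T \<circ> S = S \<circ> T"
  shows "T \<in> generated_subalgebra S"
proof (rule hessenberg_centralizer[OF basis S_End _ _ T TS])
  fix j assume j: "j < d"
  have "entry S (Suc j) j = (1 - inverse (midpoint q d x j)) * entry Z (Suc j) j"
    using j entry_Y(1)[OF j]
    by (simp add: coordinate_linear[OF basis] eigenvector coordinate_basis[OF basis] algebra_simps)
  then show "entry S (Suc j) j \<noteq> 0"
    using mid[OF j] entry_subdiagonal[OF j] by simp
next
  fix i j assume ij: "i \<le> d" "Suc j < i"
  then show "entry S i j = 0"
    using entry_tridiagonal[of i j]
    by (simp add: coordinate_linear[OF basis] eigenvector coordinate_basis[OF basis])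
qed

end

section \<open>Products of two of the maps W\<close>

context vector_space
begin

lemma q_racah_eigenbasis_exists:
  assumes "q \<noteq> 0" "q ^ 4 \<noteq> 1" "x \<noteq> 0" "X \<in> End" "Y \<in> End" "Z \<in> End"
    and "standard_ordering d (theta q d x) X Y Z" "q_relation q k Y Z X"
  obtains v where "q_racah_eigenbasis scale q x k d v X Y Z"
  using assms vector_space_axioms
  unfolding standard_ordering_def q_racah_eigenbasis_def q_racah_eigenbasis_axioms_def eigenspace_def
  by (auto dest: bij_betw_imp_inj_on)

text \<open>Moving the sum past the \<open>W\<close> of \<open>X\<close> creates \<open>[X, Y]/(q - q\<^sup>-\<^sup>1)\<close>, and moving it past the \<open>W\<close>
  of \<open>Y\<close> removes exactly this term, because \<open>X\<close> comes last in the triple \<open>Y, Z, X\<close>.\<close>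

lemma W_product_commutes:
  assumes "q_racah_eigenbasis scale q x k d v X Y Z"
    and "q_racah_eigenbasis scale q y l d w Y Z X"
  defines "S \<equiv> \<lambda>u. X u + Y u + Z u"
  shows "W_map q d y Y \<circ> W_map q d x X \<in> End"
    and "(W_map q d y Y \<circ> W_map q d x X) \<circ> S = S \<circ> (W_map q d y Y \<circ> W_map q d x X)"
proof -
  interpret X: q_racah_eigenbasis scale q x k d v X Y Z by fact
  interpret Y: q_racah_eigenbasis scale q y l d w Y Z X by fact
  show "W_map q d y Y \<circ> W_map q d x X \<in> End"
    using X.W_map_End Y.W_map_End by (simp add: End_iff)
  show "(W_map q d y Y \<circ> W_map q d x X) \<circ> S = S \<circ> (W_map q d y Y \<circ> W_map q d x X)"
  proof
    fix u
    let ?V = "W_map q d x X" and ?W = "W_map q d y Y"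
    have "?W (?V (S u)) = ?W (Y (?V u) + Z (?V u) + X (?V u)
        + scale (1 / (q - inverse q)) (X (Y (?V u)) - Y (X (?V u))))"
      unfolding S_def X.W_S by (simp only: add_ac)
    also have "\<dots> = S (?W (?V u))"
      unfolding S_def Y.S_W[symmetric] by (simp only: add_ac)
    finally show "((?W \<circ> ?V) \<circ> S) u = (S \<circ> (?W \<circ> ?V)) u" by simp
  qed
qed

end

theorem corollary13p3:
  fixes scale :: "'f::field \<Rightarrow> 'v::ab_group_add \<Rightarrow> 'v"
    and d :: nat
    and q a b c :: 'f
    and A B C W W' W'' S :: "'v \<Rightarrow> 'v"
  assumes "vector_space scale"
    and "vector_space.dim scale (UNIV :: 'v set) = d + 1"
    and "q \<noteq> 0" and "q ^ 4 \<noteq> 1"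
    and "a \<noteq> 0" and "b \<noteq> 0" and "c \<noteq> 0"
    and "\<forall>i\<in>{1..d}. q ^ (2 * i) \<noteq> 1"
    and "\<forall>k\<in>{1 - int d..int d - 1}.
           a ^ 2 \<noteq> q powi (2 * k) \<and> b ^ 2 \<noteq> q powi (2 * k) \<and> c ^ 2 \<noteq> q powi (2 * k)"
    and "\<forall>i<d. let r = q powi (int d - 1 - 2 * int i) in
           a * b * c \<noteq> r \<and> inverse a * b * c \<noteq> r
           \<and> a * inverse b * c \<noteq> r \<and> a * b * inverse c \<noteq> r"
    and "vector_space.leonard_triple scale d A B C"
    and "vector_space.q_racah_huang_data scale q a b c d A B C"
    and "W = vector_space.W_map scale q d a A"
    and "W' = vector_space.W_map scale q d b B"
    and "W'' = vector_space.W_map scale q d c C"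
    and "S = (\<lambda>v. A v + B v + C v)"
  shows "(\<forall>X \<in> vector_space.End scale.
            X \<circ> S = S \<circ> X \<longrightarrow> X \<in> vector_space.generated_subalgebra scale S)
         \<and> W' \<circ> W \<in> vector_space.generated_subalgebra scale S
         \<and> W'' \<circ> W' \<in> vector_space.generated_subalgebra scale S
         \<and> W \<circ> W'' \<in> vector_space.generated_subalgebra scale S"
proof -
  interpret vector_space scale by fact
  have ABC: "A \<in> End" "B \<in> End" "C \<in> End"
    using assms(11) by (auto simp: leonard_triple_def)
  note basis = q_racah_eigenbasis_exists[OF assms(3,4)]
  note huang = assms(12)[unfolded q_racah_huang_data_def]
  obtain u where u: "q_racah_eigenbasis scale q a (alpha q d b c a) d u A B C"
    using basis[OF assms(5) ABC(1,2,3)] huang by blast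
  obtain v where v: "q_racah_eigenbasis scale q b (alpha q d c a b) d v B C A"
    using basis[OF assms(6) ABC(2,3,1)] huang by blast
  obtain w where w: "q_racah_eigenbasis scale q c (alpha q d a b c) d w C A B"
    using basis[OF assms(7) ABC(3,1,2)] huang by blast
  interpret A: q_racah_eigenbasis scale q a "alpha q d b c a" d u A B C by fact
  have S: "S = (\<lambda>u. A u + B u + C u)" "S = (\<lambda>u. B u + C u + A u)" "S = (\<lambda>u. C u + A u + B u)"
    by (simp_all add: assms(16) fun_eq_iff add_ac)
  have mid: "midpoint q d a i \<noteq> 1" if i: "i < d" for i
  proof
    assume 1: "midpoint q d a i = 1"
    \<comment> \<open>The value \<open>a = q\<^bsup>d-1-2i\<^esup>\<close> that this forces has a forbidden square.\<close>
    let ?k = "int d - 1 - 2 * int i"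
    have "q powi (2 * int i + 1 - int d) * q powi ?k = 1"
      using power_int_add[of q "2 * int i + 1 - int d" ?k] assms(3) by simp
    then have "a = q powi ?k"
      using 1 mult.assoc[of a "q powi (2 * int i + 1 - int d)" "q powi ?k"]
      by (simp only: midpoint_def mult_1_left mult_1_right)
    then have "a ^ 2 = q powi (2 * ?k)"
      using power_int_power'[of q ?k 2] by (simp add: mult.commute)
    moreover have "?k \<in> {1 - int d..int d - 1}" using i by auto
    ultimately show False using assms(9) by blast
  qed
  have centralizer: "X \<in> generated_subalgebra S" if "X \<in> End" "X \<circ> S = S \<circ> X" for X
    using A.S_centralizer[OF mid that(1)] that(2) by (simp add: S(1))
  show ?thesis
    using centralizer W_product_commutes[OF u v, folded S(1)]
      W_product_commutes[OF v w, folded S(2)] W_product_commutes[OF w u, folded S(3)]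
    by (simp add: assms(13-15))
qed

end
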